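(* Let $\overline{m}$ be an odd positive integer, and consider the following two-agent game in which each agent has $m=2\overline{m}$ actions. Agent 1 chooses a row and agent 2 chooses a column, and for $i=1,2$ the utility matrix of agent $i$ is \[ U_i=\begin{bmatrix} U_i^{1,1} & U_i^{1,2}\\ U_i^{2,1} & U_i^{2,2}\end{bmatrix}, \] where the blocks are $\overline{m}\times\overline{m}$ matrices with entries, for $r,s\in\{1,\ldots,\overline{m}\}$ ($r$ the row index and $s$ the column index within the block): \[ U_1^{2,1}(r,s)=\begin{cases}-\overline{m}&\text{if } r=s\\ 1&\text{otherwise}\end{cases},\qquad U_1^{1,2}(r,s)=-\overline{m},\qquad U_1^{2,2}(r,s)=0, \] \[ U_2^{2,1}=U_1^{1,2},\qquad U_2^{1,2}=U_1^{2,1},\qquad U_2^{2,2}=U_1^{2,2}, \] and, for $r,s\le\overline{m}-1$, $U_1^{1,1}(r,s)=1$ if $r+s$ is odd and $0$ otherwise, $U_2^{1,1}(r,s)=1$ if $r+s$ is even and $0$ otherwise, while all the other entries of $U_1^{1,1}$ and $U_2^{1,1}$ (those with $r=\overline{m}$ or $s=\overline{m}$) are equal to $\tfrac12$. Then this game has a strong Nash equilibrium with support sizes $|S_1|=|S_2|=\overline{m}$, and it has no other strong Nash equilibrium.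
   Context: In a two-agent game, a mixed strategy of agent $i$ is a probability distribution on the agent's actions, agents randomize independently, and utilities extend by expectation. The support $S_i$ is the set of actions agent $i$ plays with positive probability. A strong Nash equilibrium (SNE) is a mixed profile $\mathbf{x}=(\mathbf{x}_1,\mathbf{x}_2)$ such that for no nonempty coalition $C\subseteq\{1,2\}$ are there mixed strategies for the members of $C$ such that, when they play these and the agents outside $C$ keep their strategies in $\mathbf{x}$, every member of $C$ obtains a strictly larger expected utility than in $\mathbf{x}$.
   Formalization: "No other strong Nash equilibrium" is replaced by "every strong Nash equilibrium has the same supports S_1, S_2": uniqueness of the profile fails for odd m̄ ≥ 3, e.g. m̄=3 with both agents playing (1/3,1/3,1/3,0,0,0) or both playing (3/8,3/8,1/4,0,0,0). *)

theory Defs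
  imports "HOL-Probability.Probability"
begin

datatype agent = Agent1 | Agent2

definition mixed_strategy :: "'a set \<Rightarrow> 'a pmf \<Rightarrow> bool" where
  "mixed_strategy A p \<longleftrightarrow> set_pmf p \<subseteq> A"

text \<open>\<open>u i r s\<close> is the utility of agent \<open>i\<close> when agent 1 plays \<open>r\<close> and agent 2 plays \<open>s\<close>.
  The use of \<open>pair_pmf\<close> expresses that the agents randomize independently.\<close>

definition expected_utility ::
    "(agent \<Rightarrow> 'a \<Rightarrow> 'a \<Rightarrow> real) \<Rightarrow> (agent \<Rightarrow> 'a pmf) \<Rightarrow> agent \<Rightarrow> real" where
  "expected_utility u x i =
     measure_pmf.expectation (pair_pmf (x Agent1) (x Agent2)) (\<lambda>(r, s). u i r s)"

text \<open>\<open>override_on x y C\<close> is the profile in which the members of \<open>C\<close> play according to \<open>y\<close>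
  and the other agents according to \<open>x\<close>. Only the values of \<open>y\<close> on \<open>C\<close> matter.\<close>

definition strong_nash_equilibrium ::
    "(agent \<Rightarrow> 'a set) \<Rightarrow> (agent \<Rightarrow> 'a \<Rightarrow> 'a \<Rightarrow> real) \<Rightarrow> (agent \<Rightarrow> 'a pmf) \<Rightarrow> bool" where
  "strong_nash_equilibrium A u x \<longleftrightarrow>
     (\<forall>i. mixed_strategy (A i) (x i)) \<and>
     \<not> (\<exists>C y. C \<noteq> {} \<and> (\<forall>i\<in>C. mixed_strategy (A i) (y i)) \<and>
          (\<forall>i\<in>C. expected_utility u (override_on x y C) i > expected_utility u x i))"

definition block_matrix ::
    "nat \<Rightarrow> (nat \<Rightarrow> nat \<Rightarrow> real) \<Rightarrow> (nat \<Rightarrow> nat \<Rightarrow> real) \<Rightarrow> (nat \<Rightarrow> nat \<Rightarrow> real) \<Rightarrow>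
     (nat \<Rightarrow> nat \<Rightarrow> real) \<Rightarrow> nat \<Rightarrow> nat \<Rightarrow> real" where
  "block_matrix k B11 B12 B21 B22 r s =
     (if r \<le> k then (if s \<le> k then B11 r s else B12 r (s - k))
      else (if s \<le> k then B21 (r - k) s else B22 (r - k) (s - k)))"

text \<open>The blocks are indexed from 1. The parameter \<open>k\<close> is the block size, half the number
  of actions.\<close>

definition U1_11 :: "nat \<Rightarrow> nat \<Rightarrow> nat \<Rightarrow> real" where
  "U1_11 k r s = (if r \<le> k - 1 \<and> s \<le> k - 1 then (if odd (r + s) then 1 else 0) else 1 / 2)"

definition U2_11 :: "nat \<Rightarrow> nat \<Rightarrow> nat \<Rightarrow> real" where
  "U2_11 k r s = (if r \<le> k - 1 \<and> s \<le> k - 1 then (if even (r + s) then 1 else 0) else 1 / 2)"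

definition U1_21 :: "nat \<Rightarrow> nat \<Rightarrow> nat \<Rightarrow> real" where
  "U1_21 k r s = (if r = s then - real k else 1)"

definition U1_12 :: "nat \<Rightarrow> nat \<Rightarrow> nat \<Rightarrow> real" where
  "U1_12 k r s = - real k"

definition U1_22 :: "nat \<Rightarrow> nat \<Rightarrow> nat \<Rightarrow> real" where
  "U1_22 k r s = 0"

definition game_actions :: "nat \<Rightarrow> agent \<Rightarrow> nat set" where
  "game_actions k i = {1..2 * k}"

text \<open>Agent 2 reuses the off-diagonal blocks of agent 1 with the positions exchanged,
  but not transposed.\<close>

fun game_utility :: "nat \<Rightarrow> agent \<Rightarrow> nat \<Rightarrow> nat \<Rightarrow> real" where
  "game_utility k Agent1 = block_matrix k (U1_11 k) (U1_12 k) (U1_21 k) (U1_22 k)"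
| "game_utility k Agent2 = block_matrix k (U2_11 k) (U1_21 k) (U1_12 k) (U1_22 k)"

end

theory Submission
  imports Defs
begin

text \<open>In every outcome the utilities sum to at most 1, with equality only if both agents play one of
  their first \<open>k\<close> actions. Uniform play on these actions is an equilibrium that gives \<open>1/2\<close> to
  each agent, and no coalition of both can improve on it. Conversely, for \<open>k \<ge> 3\<close> the two agents
  can jointly reach every utility pair \<open>(t, 1 - t)\<close> with \<open>0 \<le> t \<le> 1\<close>, so in a strong Nash
  equilibrium either the utilities sum to at least 1, hence both agents play only their first \<open>k\<close>
  actions, or one agent obtains 1 and the other a negative utility, which a unilateral deviation
  rules out. In the first case, if an agent omits one of the first \<open>k\<close> actions, say \<open>r\<close>, then the
  opponent gets 1 with action \<open>k + r\<close>, so that the agent gets at most 0, although action \<open>k\<close>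
  guarantees \<open>1/2\<close>.\<close>

section \<open>Expectations of finitely supported distributions\<close>

lemma expectation_mono_finite:
  fixes f g :: "'a \<Rightarrow> real"
  assumes "finite (set_pmf p)" "\<And>a. a \<in> set_pmf p \<Longrightarrow> f a \<le> g a"
  shows "measure_pmf.expectation p f \<le> measure_pmf.expectation p g"
  using assms
  by (intro integral_mono_AE integrable_measure_pmf_finite) (auto simp: AE_measure_pmf_iff)

lemma expectation_eq_const:
  fixes f :: "'a \<Rightarrow> real"
  assumes "\<And>a. a \<in> set_pmf p \<Longrightarrow> f a = c"
  shows "measure_pmf.expectation p f = c"
proof -
  have "measure_pmf.expectation p f = measure_pmf.expectation p (\<lambda>_. c)"
    using assms by (intro integral_cong_AE) (auto simp: AE_measure_pmf_iff)
  then show ?thesis by simp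
qed

text \<open>The nonnegative difference \<open>g - f\<close> has mean 0, hence vanishes on the
  support. This turns tight bounds on utilities into equalities at each outcome.\<close>

lemma eq_on_set_pmf_if_expectation_ge:
  fixes f g :: "'a \<Rightarrow> real"
  assumes fin: "finite (set_pmf p)"
    and le: "\<And>a. a \<in> set_pmf p \<Longrightarrow> f a \<le> g a"
    and ge: "measure_pmf.expectation p g \<le> measure_pmf.expectation p f"
    and a: "a \<in> set_pmf p"
  shows "f a = g a"
proof -
  note int = integrable_measure_pmf_finite[OF fin]
  have nonneg: "AE a in measure_pmf p. 0 \<le> g a - f a"
    using le by (auto simp: AE_measure_pmf_iff)
  have "measure_pmf.expectation p f = measure_pmf.expectation p g"
    by (intro antisym ge expectation_mono_finite fin le)
  then have "measure_pmf.expectation p (\<lambda>a. g a - f a) = 0"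
    by (simp add: Bochner_Integration.integral_diff int)
  then have "AE a in measure_pmf p. g a - f a = 0"
    using integral_nonneg_eq_0_iff_AE[OF int nonneg] by simp
  then show ?thesis
    using a by (auto simp: AE_measure_pmf_iff)
qed

lemma expectation_pair_pmf_finite:
  fixes f :: "'a \<times> 'b \<Rightarrow> real"
  assumes "finite (set_pmf p)" "finite (set_pmf q)"
  shows "measure_pmf.expectation (pair_pmf p q) f =
    measure_pmf.expectation p (\<lambda>a. measure_pmf.expectation q (\<lambda>b. f (a, b)))"
proof -
  have q: "measure_pmf.expectation q g = (\<Sum>b\<in>set_pmf q. g b * pmf q b)" for g :: "'b \<Rightarrow> real"
    using assms by (intro integral_measure_pmf_real) auto
  have p: "measure_pmf.expectation p g = (\<Sum>b\<in>set_pmf p. g b * pmf p b)" for g :: "'a \<Rightarrow> real"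
    using assms by (intro integral_measure_pmf_real) auto
  have "measure_pmf.expectation (pair_pmf p q) f =
      (\<Sum>x\<in>set_pmf p \<times> set_pmf q. f x * pmf (pair_pmf p q) x)"
    using assms by (intro integral_measure_pmf_real) auto
  also have "\<dots> = (\<Sum>a\<in>set_pmf p. (\<Sum>b\<in>set_pmf q. f (a, b) * pmf q b) * pmf p a)"
    by (simp add: sum.cartesian_product' pmf_pair sum_distrib_left sum_distrib_right mult_ac)
  finally show ?thesis by (simp add: p q)
qed

section \<open>The game from the point of view of one agent\<close>

fun opponent :: "agent \<Rightarrow> agent" where
  "opponent Agent1 = Agent2"
| "opponent Agent2 = Agent1"

lemma opponent_opponent [simp]: "opponent (opponent i) = i"
  by (cases i) auto

text \<open>The agent's own action comes first, so that one argument serves both agents.\<close>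

fun payoff :: "nat \<Rightarrow> agent \<Rightarrow> nat \<Rightarrow> nat \<Rightarrow> real" where
  "payoff k Agent1 r s = game_utility k Agent1 r s"
| "payoff k Agent2 r s = game_utility k Agent2 s r"

abbreviation value_of :: "nat \<Rightarrow> (agent \<Rightarrow> nat pmf) \<Rightarrow> agent \<Rightarrow> real" where
  "value_of k \<equiv> expected_utility (game_utility k)"

abbreviation sne :: "nat \<Rightarrow> (agent \<Rightarrow> nat pmf) \<Rightarrow> bool" where
  "sne k \<equiv> strong_nash_equilibrium (game_actions k) (game_utility k)"

lemma value_of_payoff:
  "value_of k x i =
    measure_pmf.expectation (pair_pmf (x i) (x (opponent i))) (\<lambda>(r, s). payoff k i r s)"
proof (cases i)
  case Agent1
  then show ?thesis by (simp add: expected_utility_def)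
next
  case Agent2
  then show ?thesis
    by (subst pair_commute_pmf) (simp add: expected_utility_def case_prod_unfold)
qed

text \<open>The block \<open>U_1^{2,1}\<close> is symmetric, so its untransposed reuse for agent 2 still makes
  \<open>payoff\<close> follow the same pattern for both agents.\<close>

lemma payoff_outside:
  assumes "r > k \<or> s > k" "r > 0" "s > 0"
  shows "payoff k i r s =
    (if r \<le> k then - real k else if s \<le> k then (if r = k + s then - real k else 1) else 0)"
  using assms by (cases i) (auto simp: block_matrix_def U1_12_def U1_21_def U1_22_def)

lemma payoff_last:
  assumes "r \<le> k" "s \<le> k" "r = k \<or> s = k" "k > 0"
  shows "payoff k i r s = 1 / 2"
  using assms by (cases i) (auto simp: block_matrix_def U1_11_def U2_11_def)

lemma payoff_bounds: "r \<le> k \<Longrightarrow> s \<le> k \<Longrightarrow> 0 \<le> payoff k i r s \<and> payoff k i r s \<le> 1"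
  by (cases i) (auto simp: block_matrix_def U1_11_def U2_11_def)

lemma payoff_add:
  "r \<le> k \<Longrightarrow> s \<le> k \<Longrightarrow> payoff k i r s + payoff k (opponent i) s r = 1"
  by (cases i) (auto simp: block_matrix_def U1_11_def U2_11_def add.commute)

lemma payoff_le_1: "r > 0 \<Longrightarrow> s > 0 \<Longrightarrow> payoff k i r s \<le> 1"
  using payoff_bounds[of r k s i] payoff_outside[of k r s i] by (cases "r \<le> k \<and> s \<le> k") auto

text \<open>If one agent alone leaves the first \<open>k\<close> actions, it gets at most 1 and the
  other gets \<open>- real k\<close>, a sum of at most \<open>1 - k\<close>. If both leave, each
  gets 0.\<close>

lemma payoff_add_le:
  assumes "k > 0" "r > 0" "s > 0" "r > k \<or> s > k"
  shows "payoff k i r s + payoff k (opponent i) s r \<le> 0"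
  using assms payoff_outside[of k r s i] payoff_outside[of k s r "opponent i"] by auto

section \<open>Deviations\<close>

locale block_game =
  fixes k :: nat
  assumes k_pos: "k > 0"
begin

definition valid :: "(agent \<Rightarrow> nat pmf) \<Rightarrow> bool" where
  "valid x \<longleftrightarrow> (\<forall>i. set_pmf (x i) \<subseteq> {1..2 * k})"

lemma valid_finite: "valid x \<Longrightarrow> finite (set_pmf (x i))"
  unfolding valid_def by (meson finite_atLeastAtMost finite_subset)

lemma valid_mem: "valid x \<Longrightarrow> r \<in> set_pmf (x i) \<Longrightarrow> 0 < r \<and> r \<le> 2 * k"
  unfolding valid_def by force

lemma sne_valid: "sne k x \<Longrightarrow> valid x"
  by (auto simp: strong_nash_equilibrium_def mixed_strategy_def game_actions_def valid_def)

text \<open>Under a single expectation, bounds on the sum of utilities can be checked outcome by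
  outcome.\<close>

lemma value_of_add:
  assumes "valid x"
  shows "value_of k x i + value_of k x (opponent i) =
    measure_pmf.expectation (pair_pmf (x i) (x (opponent i)))
      (\<lambda>(r, s). payoff k i r s + payoff k (opponent i) s r)"
proof -
  have fin: "finite (set_pmf (pair_pmf (x i) (x (opponent i))))"
    using assms by (simp add: valid_finite)
  have "value_of k x (opponent i) =
      measure_pmf.expectation (pair_pmf (x i) (x (opponent i)))
        (\<lambda>(r, s). payoff k (opponent i) s r)"
    unfolding value_of_payoff
    by (subst pair_commute_pmf) (simp add: case_prod_unfold)
  then show ?thesis
    by (simp add: value_of_payoff case_prod_unfold Bochner_Integration.integral_add
        integrable_measure_pmf_finite[OF fin])
qed

lemma value_of_add_le:
  assumes "valid x"
  shows "value_of k x Agent1 + value_of k x Agent2 \<le> 1"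
proof -
  have "value_of k x Agent1 + value_of k x (opponent Agent1) \<le>
      measure_pmf.expectation (pair_pmf (x Agent1) (x (opponent Agent1))) (\<lambda>_. 1)"
    unfolding value_of_add[OF assms]
  proof (rule expectation_mono_finite)
    fix a assume "a \<in> set_pmf (pair_pmf (x Agent1) (x (opponent Agent1)))"
    then obtain r s where a: "a = (r, s)" "r > 0" "s > 0"
      using valid_mem[OF assms] by (cases a) auto
    show "(case a of (r, s) \<Rightarrow> payoff k Agent1 r s + payoff k (opponent Agent1) s r) \<le> 1"
      using payoff_add_le[OF k_pos a(2,3), of Agent1] payoff_add[of r k s Agent1] a
      by (cases "r \<le> k \<and> s \<le> k") auto
  qed (use assms in \<open>simp add: valid_finite\<close>)
  then show ?thesis by simp
qed

lemma sne_no_deviation: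
  assumes "sne k x" "C \<noteq> {}" "\<And>i. i \<in> C \<Longrightarrow> set_pmf (y i) \<subseteq> {1..2 * k}"
  shows "\<exists>i\<in>C. value_of k (override_on x y C) i \<le> value_of k x i"
  using assms unfolding strong_nash_equilibrium_def mixed_strategy_def game_actions_def
  by (meson linorder_not_less)

lemma sne_unilateral:
  assumes "sne k x" "a \<in> {1..2 * k}"
  shows "measure_pmf.expectation (x (opponent i)) (payoff k i a) \<le> value_of k x i"
proof -
  let ?y = "\<lambda>_::agent. return_pmf a"
  have "value_of k (override_on x ?y {i}) i \<le> value_of k x i"
    using sne_no_deviation[OF assms(1), of "{i}" ?y] assms(2) by simp
  moreover have "override_on x ?y {i} (opponent i) = x (opponent i)"
    by (cases i) (auto simp: override_on_def)
  ultimately show ?thesis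
    by (simp add: value_of_payoff pair_return_pmf1)
qed

lemma sne_bilateral:
  assumes "sne k x" "valid y"
  shows "value_of k y Agent1 \<le> value_of k x Agent1 \<or> value_of k y Agent2 \<le> value_of k x Agent2"
proof -
  have "override_on x y UNIV = y"
    by (simp add: override_on_def fun_eq_iff)
  then obtain i where "value_of k y i \<le> value_of k x i"
    using sne_no_deviation[OF assms(1), of UNIV y] assms(2) by (auto simp: valid_def)
  then show ?thesis
    by (cases i) auto
qed

section \<open>Supports of strong Nash equilibria\<close>

text \<open>If the opponent gets 1, then playing \<open>k\<close> is at least as good as \<open>x i\<close> against every action of
  the opponent, and better against the first \<open>k\<close> ones.\<close>

lemma sne_value_nonneg:
  assumes "sne k x" "value_of k x (opponent i) \<ge> 1"
  shows "value_of k x i \<ge> 0"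
proof (rule ccontr)
  assume neg: "\<not> ?thesis"
  let ?P = "pair_pmf (x (opponent i)) (x i)"
  let ?Q = "pair_pmf (x i) (x (opponent i))"
  note valid = sne_valid[OF assms(1)]
  have fin: "finite (set_pmf ?P)" "finite (set_pmf ?Q)"
    using valid by (simp_all add: valid_finite)
  have one: "payoff k (opponent i) s r = 1"
    if "r \<in> set_pmf (x i)" "s \<in> set_pmf (x (opponent i))" for r s
  proof -
    have "(case (s, r) of (s, r) \<Rightarrow> payoff k (opponent i) s r) = (1::real)"
      by (rule eq_on_set_pmf_if_expectation_ge[OF fin(1), where g = "\<lambda>_. 1"])
        (use assms(2) valid_mem[OF valid] that in
          \<open>auto simp: value_of_payoff[of k x "opponent i"] intro: payoff_le_1\<close>)
    then show ?thesis by simp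
  qed
  \<comment> \<open>An opponent payoff of 1 forces \<open>r \<le> k\<close>. If
    \<open>s \<le> k\<close>, the constant sum leaves 0 for agent \<open>i\<close>, whereas
    \<open>k\<close> earns 1/2; if \<open>s > k\<close>, both \<open>r\<close> and \<open>k\<close>
    earn \<open>- real k\<close>.\<close>
  have dom: "payoff k i r s \<le> payoff k i k s \<and> (payoff k i r s = payoff k i k s \<longrightarrow> s > k)"
    if "r \<in> set_pmf (x i)" "s \<in> set_pmf (x (opponent i))" for r s
  proof -
    note pos = valid_mem[OF valid that(1)] valid_mem[OF valid that(2)]
    have r: "r \<le> k"
      using one[OF that] payoff_outside[of k s r "opponent i"] pos k_pos
      by (cases "s \<le> k"; cases "r \<le> k") auto
    show ?thesis
      using one[OF that] payoff_add[of r k s i] payoff_last[of k k s i] r pos k_pos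
        payoff_outside[of k k s i] payoff_outside[of k r s i]
      by (cases "s \<le> k") auto
  qed
  have "measure_pmf.expectation ?Q (\<lambda>(r, s). payoff k i k s) =
      measure_pmf.expectation (x (opponent i)) (payoff k i k)"
    using expectation_pair_pmf_snd[of "x i" "x (opponent i)" "payoff k i k"]
    by (simp add: case_prod_unfold)
  then have ge: "measure_pmf.expectation ?Q (\<lambda>(r, s). payoff k i k s) \<le>
      measure_pmf.expectation ?Q (\<lambda>(r, s). payoff k i r s)"
    using sne_unilateral[OF assms(1), of k i] k_pos by (simp add: value_of_payoff)
  have right: "s > k" if s: "s \<in> set_pmf (x (opponent i))" for s
  proof -
    obtain r where r: "r \<in> set_pmf (x i)"
      using set_pmf_not_empty by fast
    have "(case (r, s) of (r, s) \<Rightarrow> payoff k i r s) = (case (r, s) of (r, s) \<Rightarrow> payoff k i k s)"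
      by (rule eq_on_set_pmf_if_expectation_ge[OF fin(2) _ ge]) (use dom r s in auto)
    then show ?thesis
      using dom[OF r s] by simp
  qed
  \<comment> \<open>Against an opponent who always plays beyond \<open>k\<close>, the action
    \<open>Suc k\<close> leads to the zero block and improves on a negative value.\<close>
  have "measure_pmf.expectation (x (opponent i)) (payoff k i (Suc k)) = 0"
  proof (rule expectation_eq_const)
    fix s assume "s \<in> set_pmf (x (opponent i))"
    from right[OF this] show "payoff k i (Suc k) s = 0"
      by (simp add: payoff_outside)
  qed
  then show False
    using sne_unilateral[OF assms(1), of "Suc k" i] k_pos neg by simp
qed

lemma sne_value_add:
  assumes "sne k x" "odd k"
  shows "value_of k x Agent1 + value_of k x Agent2 \<ge> 1"
proof (cases "k = 1")
  case True
  note valid = sne_valid[OF assms(1)]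
  \<comment> \<open>With \<open>1\<close> by \<open>1\<close> blocks the off-diagonal blocks consist
    of the entry \<open>-1\<close> alone, so the agents have identical utilities.\<close>
  have eq: "game_utility k Agent1 r s = game_utility k Agent2 r s"
    if "r \<in> set_pmf (x Agent1)" "s \<in> set_pmf (x Agent2)" for r s
    using valid_mem[OF valid that(1)] valid_mem[OF valid that(2)] True
    by (auto simp: block_matrix_def U1_11_def U2_11_def U1_21_def U1_12_def U1_22_def)
  have "value_of k x Agent1 = value_of k x Agent2"
    unfolding expected_utility_def
    by (rule integral_cong_AE) (use eq in \<open>auto simp: AE_measure_pmf_iff\<close>)
  moreover have half: "value_of k (\<lambda>_. return_pmf k) i = 1 / 2" for i
    using k_pos by (simp add: value_of_payoff payoff_last)
  have "valid (\<lambda>_. return_pmf k)"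
    using k_pos by (simp add: valid_def)
  from sne_bilateral[OF assms(1) this]
  have "1 / 2 \<le> value_of k x Agent1 \<or> 1 / 2 \<le> value_of k x Agent2"
    by (simp only: half)
  ultimately show ?thesis
    by auto
next
  case False
  with assms(2) k_pos have k: "k \<ge> 3"
    by (cases "k = 2") auto
  let ?u = "value_of k x Agent1" and ?v = "value_of k x Agent2"
  have frontier: "t \<le> ?u \<or> 1 - t \<le> ?v" if t: "0 \<le> t" "t \<le> 1" for t
  proof -
    \<comment> \<open>The outcomes \<open>(1, 1)\<close> and \<open>(1, 2)\<close> give the utility
      pairs (0, 1) and (1, 0). Both lie in the parity part of the block because
      \<open>k - 1 \<ge> 2\<close>.\<close>
    define y where "y i = (case i of Agent1 \<Rightarrow> return_pmf 1
      | Agent2 \<Rightarrow> map_pmf (\<lambda>b. if b then 2 else (1::nat)) (bernoulli_pmf t))" for i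
    have "valid y"
      using k by (auto simp: valid_def y_def split: agent.split)
    moreover have "value_of k y Agent1 = t" "value_of k y Agent2 = 1 - t"
      using k t diff_le_mono[OF k, of 1]
      by (simp_all add: expected_utility_def y_def pair_return_pmf1 block_matrix_def U1_11_def
          U2_11_def)
    ultimately show ?thesis
      using sne_bilateral[OF assms(1), of y] by simp
  qed
  show ?thesis
  proof (rule ccontr)
    assume less: "\<not> ?thesis"
    \<comment> \<open>At \<open>t = 0\<close>, either \<open>?u \<ge> 0\<close> directly or
      \<open>?v \<ge> 1\<close>, where \<open>sne_value_nonneg\<close> applies.\<close>
    have u: "?u \<ge> 0"
      using frontier[of 0] sne_value_nonneg[OF assms(1), of Agent1] by fastforce
    have v: "?v \<ge> 0"
      using frontier[of 1] sne_value_nonneg[OF assms(1), of Agent2] by fastforce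
    \<comment> \<open>This \<open>t\<close> shares the slack equally: it exceeds \<open>?u\<close>,
      and \<open>1 - t\<close> exceeds \<open>?v\<close>, by half of
      \<open>1 - ?u - ?v\<close>.\<close>
    show False
      using frontier[of "(?u + 1 - ?v) / 2"] less u v by (simp add: field_simps)
  qed
qed

text \<open>The sum of utilities is at most 1 at each outcome and has mean at least 1, so it is 1
  throughout the support, which excludes outcomes outside the first block.\<close>

lemma sne_support_le:
  assumes "sne k x" "odd k" "r \<in> set_pmf (x i)"
  shows "r \<le> k"
proof -
  let ?P = "pair_pmf (x i) (x (opponent i))"
  note valid = sne_valid[OF assms(1)]
  have fin: "finite (set_pmf ?P)"
    using valid by (simp add: valid_finite)
  have le: "payoff k i r s + payoff k (opponent i) s r \<le> 1"
    if "r \<in> set_pmf (x i)" "s \<in> set_pmf (x (opponent i))" for r s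
    using payoff_add_le[OF k_pos, of r s i] payoff_add[of r k s i] valid_mem[OF valid that(1)]
      valid_mem[OF valid that(2)]
    by (cases "r \<le> k \<and> s \<le> k") auto
  have "value_of k x i + value_of k x (opponent i) \<ge> 1"
    using sne_value_add[OF assms(1,2)] by (cases i) auto
  then have ge: "measure_pmf.expectation ?P (\<lambda>_. 1) \<le> measure_pmf.expectation ?P
      (\<lambda>(r, s). payoff k i r s + payoff k (opponent i) s r)"
    by (simp add: value_of_add[OF valid])
  obtain s where s: "s \<in> set_pmf (x (opponent i))"
    using set_pmf_not_empty by fast
  have "(case (r, s) of (r, s) \<Rightarrow> payoff k i r s + payoff k (opponent i) s r) = 1"
    by (rule eq_on_set_pmf_if_expectation_ge[OF fin _ ge]) (use le assms(3) s in auto)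
  then show ?thesis
    using payoff_add_le[OF k_pos, of r s i] valid_mem[OF valid assms(3)] valid_mem[OF valid s]
    by force
qed

lemma sne_support:
  assumes "sne k x" "odd k"
  shows "set_pmf (x i) = {1..k}"
proof (rule ccontr)
  assume neq: "\<not> ?thesis"
  note valid = sne_valid[OF assms(1)]
  have "set_pmf (x i) \<subseteq> {1..k}"
    using sne_support_le[OF assms] valid_mem[OF valid, of _ i] by force
  with neq obtain r where r: "r \<in> {1..k}" "r \<notin> set_pmf (x i)"
    by blast
  \<comment> \<open>The only bad entry of row \<open>k + r\<close> within the first \<open>k\<close>
    columns is at \<open>r\<close>, which is never played.\<close>
  have "payoff k (opponent i) (k + r) s = 1" if "s \<in> set_pmf (x i)" for s
    using payoff_outside[of k "k + r" s "opponent i"] r that sne_support_le[OF assms that]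
      valid_mem[OF valid that]
    by auto
  then have "measure_pmf.expectation (x i) (payoff k (opponent i) (k + r)) = 1"
    by (rule expectation_eq_const)
  then have "value_of k x (opponent i) \<ge> 1"
    using sne_unilateral[OF assms(1), of "k + r" "opponent i"] r by auto
  moreover have "measure_pmf.expectation (x (opponent i)) (payoff k i k) = 1 / 2"
    by (rule expectation_eq_const, rule payoff_last)
      (use sne_support_le[OF assms] k_pos in auto)
  then have "value_of k x i \<ge> 1 / 2"
    using sne_unilateral[OF assms(1), of k i] k_pos by auto
  ultimately show False
    using value_of_add_le[OF valid] by (cases i) auto
qed

section \<open>The uniform equilibrium\<close>

definition uniform :: "agent \<Rightarrow> nat pmf" where
  "uniform i = pmf_of_set {1..k}"

lemma set_uniform: "set_pmf (uniform i) = {1..k}"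
  using k_pos by (simp add: uniform_def)

lemma valid_uniform: "valid uniform"
  by (auto simp: valid_def set_uniform)

lemma sum_parity:
  "(\<Sum>s = 1..2 * n. if odd (r + s) then 1 else 0) = real n"
  "(\<Sum>s = 1..2 * n. if even (r + s) then 1 else 0) = real n"
  by (induction n) auto

text \<open>Oddness of \<open>k\<close> matters here: the first \<open>k - 1\<close> entries of a
  row other than the last split evenly into zeros and ones, for either agent, and the final entry is
  1/2.\<close>

lemma sum_payoff_top:
  assumes "odd k" "0 < r" "r \<le> k"
  shows "(\<Sum>s = 1..k. payoff k i r s) = real k / 2"
proof (cases "r = k")
  case True
  then show ?thesis
    using k_pos by (simp add: payoff_last)
next
  case False
  with assms(3) have r: "r \<le> k - 1" "r \<le> k" by auto
  obtain n where n: "k = Suc (2 * n)"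
    using assms(1) by (auto elim!: oddE)
  have "(\<Sum>s = 1..2 * n. payoff k i r s) = real n"
  proof (cases i)
    case Agent1
    have "(\<Sum>s = 1..2 * n. payoff k i r s) = (\<Sum>s = 1..2 * n. if odd (r + s) then 1 else 0)"
      using Agent1 r n by (intro sum.cong) (auto simp: block_matrix_def U1_11_def)
    then show ?thesis by (simp only: sum_parity)
  next
    case Agent2
    have "(\<Sum>s = 1..2 * n. payoff k i r s) = (\<Sum>s = 1..2 * n. if even (r + s) then 1 else 0)"
      using Agent2 r n by (intro sum.cong) (auto simp: block_matrix_def U2_11_def)
    then show ?thesis by (simp only: sum_parity)
  qed
  moreover have "payoff k i r k = 1 / 2"
    using r k_pos by (intro payoff_last) auto
  ultimately show ?thesis
    by (simp add: n)
qed

lemma sum_payoff_bottom: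
  assumes "k < r" "r \<le> 2 * k"
  shows "(\<Sum>s = 1..k. payoff k i r s) = - 1"
proof -
  \<comment> \<open>The row is constantly 1 apart from a drop of \<open>k + 1\<close> at the column
    \<open>r - k\<close>.\<close>
  have "(\<Sum>s = 1..k. payoff k i r s) = (\<Sum>s = 1..k. 1 - (if r - k = s then real k + 1 else 0))"
    using assms by (intro sum.cong) (auto simp: payoff_outside)
  also have "\<dots> = - 1"
  proof -
    have "r - k \<in> {1..k}"
      using assms by auto
    then show ?thesis
      by (simp add: sum_subtractf)
  qed
  finally show ?thesis .
qed

lemma expectation_uniform:
  "measure_pmf.expectation (uniform j) f = (\<Sum>s = 1..k. f s) / real k"
  using k_pos by (simp add: uniform_def integral_pmf_of_set)

lemma value_uniform:
  assumes "odd k"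
  shows "value_of k uniform i = 1 / 2"
proof -
  have "measure_pmf.expectation (uniform (opponent i)) (payoff k i r) = 1 / 2"
    if "r \<in> set_pmf (uniform i)" for r
    using that assms k_pos
    by (simp add: expectation_uniform sum_payoff_top set_uniform del: One_nat_def)
  then have "measure_pmf.expectation (uniform i)
      (\<lambda>r. measure_pmf.expectation (uniform (opponent i)) (payoff k i r)) = 1 / 2"
    by (rule expectation_eq_const)
  then show ?thesis
    by (simp add: value_of_payoff expectation_pair_pmf_finite set_uniform)
qed

text \<open>Against \<open>uniform\<close>, a pure action earns 1/2 if it is at most
  \<open>k\<close> and \<open>- 1 / k\<close> otherwise; mixing cannot exceed the maximum.\<close>

lemma value_uniform_deviation:
  assumes "odd k" "set_pmf (y i) \<subseteq> {1..2 * k}" "y (opponent i) = uniform (opponent i)"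
  shows "value_of k y i \<le> 1 / 2"
proof -
  have fin: "finite (set_pmf (y i))"
    using assms(2) finite_subset by blast
  have "measure_pmf.expectation (uniform (opponent i)) (payoff k i r) \<le> 1 / 2"
    if "r \<in> set_pmf (y i)" for r
  proof (cases "r \<le> k")
    case True
    then show ?thesis
      using assms that k_pos
      by (auto simp: expectation_uniform sum_payoff_top simp del: One_nat_def)
  next
    case False
    moreover have "r \<le> 2 * k"
      using assms(2) that by auto
    ultimately show ?thesis
      using k_pos
      by (auto simp: expectation_uniform sum_payoff_bottom simp del: One_nat_def
          intro: order_trans[of _ 0])
  qed
  then have "measure_pmf.expectation (y i)
        (\<lambda>r. measure_pmf.expectation (uniform (opponent i)) (payoff k i r)) \<le>
      measure_pmf.expectation (y i) (\<lambda>_. 1 / 2)"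
    by (rule expectation_mono_finite[OF fin])
  then show ?thesis
    by (simp add: value_of_payoff expectation_pair_pmf_finite set_uniform fin assms(3))
qed

lemma sne_uniform:
  assumes "odd k"
  shows "sne k uniform"
  unfolding strong_nash_equilibrium_def
proof (intro conjI notI)
  show "\<forall>i. mixed_strategy (game_actions k i) (uniform i)"
    using valid_uniform by (simp add: valid_def mixed_strategy_def game_actions_def)
  assume "\<exists>C y. C \<noteq> {} \<and> (\<forall>i\<in>C. mixed_strategy (game_actions k i) (y i)) \<and>
    (\<forall>i\<in>C. value_of k uniform i < value_of k (override_on uniform y C) i)"
  then obtain C y where C: "C \<noteq> {}"
    and y: "\<forall>i\<in>C. set_pmf (y i) \<subseteq> {1..2 * k}"
    and better': "\<forall>i\<in>C. value_of k uniform i < value_of k (override_on uniform y C) i"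
    unfolding mixed_strategy_def game_actions_def by blast
  have better: "value_of k (override_on uniform y C) i > 1 / 2" if "i \<in> C" for i
    using better' that value_uniform[OF assms, of i] by force
  have valid: "valid (override_on uniform y C)"
    using y valid_uniform by (auto simp: valid_def override_on_def)
  obtain i where i: "i \<in> C"
    using C by blast
  \<comment> \<open>Two deviators cannot both exceed 1/2, as the utilities sum to at most 1; a
    single one faces \<open>uniform\<close>.\<close>
  show False
  proof (cases "opponent i \<in> C")
    case True
    then have "value_of k (override_on uniform y C) i +
        value_of k (override_on uniform y C) (opponent i) > 1"
      using better[OF i] better[OF True] by simp
    then show False
      using value_of_add_le[OF valid] by (cases i) auto
  next
    case False
    then have "value_of k (override_on uniform y C) i \<le> 1 / 2"
      using valid assms by (intro value_uniform_deviation) (auto simp: valid_def)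
    then show False
      using better[OF i] by simp
  qed
qed

end

text \<open>Equilibria are compared by their supports, all equal to \<open>{1..mbar}\<close> by
  \<open>sne_support\<close>; the probabilities are not compared.\<close>

theorem corollary4p2:
  fixes mbar :: nat
  assumes "mbar > 0" and "odd mbar"
  shows "\<exists>x. strong_nash_equilibrium (game_actions mbar) (game_utility mbar) x \<and>
             card (set_pmf (x Agent1)) = mbar \<and> card (set_pmf (x Agent2)) = mbar \<and>
             (\<forall>y. strong_nash_equilibrium (game_actions mbar) (game_utility mbar) y \<longrightarrow>
                  set_pmf (y Agent1) = set_pmf (x Agent1) \<and>
                  set_pmf (y Agent2) = set_pmf (x Agent2))"
proof -
  interpret block_game mbar
    using assms(1) by unfold_locales
  show ?thesis
    using sne_uniform[OF assms(2)] sne_support[OF _ assms(2)]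
    by (intro exI[of _ uniform]) (simp add: set_uniform)
qed

end
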